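(* For all positive integers $n$, $c_b(Q_n)=1$.
   Context: Bridge-burning Cops and Robbers is played on a finite graph $G$ by a team of cops and a single robber, with full information. First each cop chooses a starting vertex (several cops may share a vertex), then the robber chooses a starting vertex. The game then proceeds in rounds; in each round, first every cop either stays put or moves along an edge of the current graph to an adjacent vertex, and then the robber either stays put or moves along an edge of the current graph. Every edge traversed by the robber is immediately deleted from the graph (cop moves delete nothing). The cops win if at some moment some cop occupies the same vertex as the robber; the robber wins if he avoids this forever. $c_b(G)$ is the minimum number of cops for which the cops have a winning strategy. $Q_n$ is the $n$-dimensional hypercube, with vertex set $\{0,1\}^n$ and two vertices adjacent iff they differ in exactly one coordinate. *)

theory Defs
  imports "Graph_Theory.Pair_Digraph"
begin

text \<open>
  A finite simple graph is a \<^locale>\<open>pair_graph\<close>: each undirected edge \<open>uv\<close> is represented by the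
  two arcs \<open>(u, v)\<close> and \<open>(v, u)\<close>.

  A robber play is the sequence \<open>r 0, r 1, \<dots>\<close> of the robber's positions, \<open>r 0\<close> being his starting
  vertex and \<open>r t\<close> his position at the end of round \<open>t\<close>.
\<close>

text \<open>
  The arcs still present after \<open>t\<close> rounds. A robber who stays put contributes only a
  pair \<open>(v, v)\<close>, which is not an arc of a simple graph.
\<close>

definition remaining_arcs :: "'a pair_pre_digraph \<Rightarrow> (nat \<Rightarrow> 'a) \<Rightarrow> nat \<Rightarrow> ('a \<times> 'a) set" where
  "remaining_arcs G r t =
     parcs G - (\<Union>s<t. {(r s, r (Suc s)), (r (Suc s), r s)})"

definition move_in :: "('a \<times> 'a) set \<Rightarrow> 'a \<Rightarrow> 'a \<Rightarrow> bool" where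
  "move_in A u v \<longleftrightarrow> v = u \<or> (u, v) \<in> A"

definition robber_play :: "'a pair_pre_digraph \<Rightarrow> (nat \<Rightarrow> 'a) \<Rightarrow> bool" where
  "robber_play G r \<longleftrightarrow>
     r 0 \<in> pverts G \<and> (\<forall>t. move_in (remaining_arcs G r t) (r t) (r (Suc t)))"

text \<open>
  A strategy for the cops maps the list of the robber's positions so far to the
  next placement of the cops, cop \<open>i\<close> going to \<open>\<sigma> h i\<close>; in particular \<open>\<sigma> []\<close> is the initial
  placement, chosen before the robber's. The earlier placements of the cops need not be
  part of the history, since \<open>\<sigma>\<close> determines them. So \<open>cops_at \<sigma> r t\<close>, the placement after the
  cops' move in round \<open>t\<close>, depends on \<open>r 0, \<dots>, r (t - 1)\<close> only.
\<close>

definition cops_at :: "('a list \<Rightarrow> nat \<Rightarrow> 'a) \<Rightarrow> (nat \<Rightarrow> 'a) \<Rightarrow> nat \<Rightarrow> nat \<Rightarrow> 'a" where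
  "cops_at \<sigma> r t = \<sigma> (map r [0..<t])"

definition cop_strategy :: "'a pair_pre_digraph \<Rightarrow> nat \<Rightarrow> ('a list \<Rightarrow> nat \<Rightarrow> 'a) \<Rightarrow> bool" where
  "cop_strategy G k \<sigma> \<longleftrightarrow>
     (\<forall>i<k. \<sigma> [] i \<in> pverts G) \<and>
     (\<forall>r. robber_play G r \<longrightarrow>
        (\<forall>t. \<forall>i<k. move_in (remaining_arcs G r t) (cops_at \<sigma> r t i) (cops_at \<sigma> r (Suc t) i)))"

text \<open>
  The two disjuncts are capture at the end of round \<open>t\<close> (or at the initial placement, for
  \<open>t = 0\<close>) and capture by the cops' move of round \<open>t + 1\<close>. Plays are formally continued after a
  capture; this is harmless, as everybody may stay put.
\<close>

definition captured :: "nat \<Rightarrow> ('a list \<Rightarrow> nat \<Rightarrow> 'a) \<Rightarrow> (nat \<Rightarrow> 'a) \<Rightarrow> bool" where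
  "captured k \<sigma> r \<longleftrightarrow>
     (\<exists>t. \<exists>i<k. cops_at \<sigma> r t i = r t \<or> cops_at \<sigma> r (Suc t) i = r t)"

definition cops_win :: "'a pair_pre_digraph \<Rightarrow> nat \<Rightarrow> bool" where
  "cops_win G k \<longleftrightarrow>
     (\<exists>\<sigma>. cop_strategy G k \<sigma> \<and> (\<forall>r. robber_play G r \<longrightarrow> captured k \<sigma> r))"

definition bb_cop_number :: "'a pair_pre_digraph \<Rightarrow> nat" where
  "bb_cop_number G = (LEAST k. cops_win G k)"

text \<open>The minimum exists: a cop on every vertex wins at once.\<close>

lemma cops_win_card:
  assumes "finite (pverts G)"
  shows "cops_win G (card (pverts G))"
proof -
  obtain f where f: "bij_betw f {0..<card (pverts G)} (pverts G)"
    using ex_bij_betw_nat_finite[OF assms] by blast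
  have "cop_strategy G (card (pverts G)) (\<lambda>_. f)"
    using bij_betwE[OF f] by (simp add: cop_strategy_def cops_at_def move_in_def)
  moreover have "captured (card (pverts G)) (\<lambda>_. f) r" if "robber_play G r" for r
  proof -
    have "r 0 \<in> f ` {0..<card (pverts G)}"
      using that bij_betw_imp_surj_on[OF f] by (simp add: robber_play_def)
    then obtain i where "i < card (pverts G)" "f i = r 0" by force
    then show ?thesis unfolding captured_def cops_at_def by blast
  qed
  ultimately show ?thesis unfolding cops_win_def by blast
qed

definition hypercube :: "nat \<Rightarrow> bool list pair_pre_digraph" where
  "hypercube n =
     \<lparr> pverts = {x. length x = n},
       parcs = {(x, y). length x = n \<and> length y = n \<and> card {i. i < n \<and> x ! i \<noteq> y ! i} = 1} \<rparr>"

lemma pair_graph_hypercube: "pair_graph (hypercube n)"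
proof -
  have fin: "finite (pverts (hypercube n))"
    using finite_lists_length_eq[of "UNIV :: bool set" n] by (simp add: hypercube_def)
  have sub: "parcs (hypercube n) \<subseteq> pverts (hypercube n) \<times> pverts (hypercube n)"
    unfolding hypercube_def by clarsimp
  have diff_commute: "{i. i < n \<and> x ! i \<noteq> y ! i} = {i. i < n \<and> y ! i \<noteq> x ! i}" for x y :: "bool list"
    by blast
  have sym: "sym (parcs (hypercube n))"
  proof (rule symI)
    fix x y assume "(x, y) \<in> parcs (hypercube n)"
    then have "length x = n \<and> length y = n \<and> card {i. i < n \<and> x ! i \<noteq> y ! i} = 1"
      by (simp add: hypercube_def)
    then have "length y = n \<and> length x = n \<and> card {i. i < n \<and> y ! i \<noteq> x ! i} = 1"
      by (metis (no_types) diff_commute)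
    then show "(y, x) \<in> parcs (hypercube n)"
      by (simp add: hypercube_def)
  qed
  show ?thesis
  proof
    show "finite (parcs (hypercube n))"
      by (rule finite_subset[OF sub]) (simp add: fin)
    show "symmetric (with_proj (hypercube n))"
      using sym by (simp add: symmetric_def)
    show "fst e \<noteq> snd e" if "e \<in> parcs (hypercube n)" for e
    proof
      assume "fst e = snd e"
      then obtain x where "e = (x, x)" by (metis prod.collapse)
      with that show False by (simp add: hypercube_def)
    qed
    show "finite (pverts (hypercube n))" by (rule fin)
    show "fst e \<in> pverts (hypercube n)" "snd e \<in> pverts (hypercube n)"
      if "e \<in> parcs (hypercube n)" for e
      using subsetD[OF sub that] by (simp_all only: mem_Times_iff)
  qed
qed

end

theory Submission
  imports Defs
begin

text \<open>
  The cop starts at the all-\<open>False\<close> vertex and copies the robber's position except on a set of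
  coordinates, the gap, on which the robber has been \<open>True\<close> throughout while the cop is still
  \<open>False\<close>. A robber move outside the gap is mirrored by the cop, a robber move inside the gap
  shrinks the gap without the cop moving, and whenever the robber stays put the cop closes one
  more coordinate. As long as the gap is nonempty, the cop leaves a vertex that the robber has never
  visited, so the edge he uses is not burnt. The robber can move only finitely often, hence the
  gap is eventually empty, and at that moment the cop sits on the robber.
\<close>

text \<open>Histories are listed with the most recent position first.\<close>

fun stays :: "'a list \<Rightarrow> nat" where
  "stays (x # y # h) = (if x = y then Suc (stays (y # h)) else stays (y # h))"
| "stays _ = 0"

text \<open>
  The \<open>k\<close>-th time the robber stays put, the cop closes coordinate \<open>k - 1\<close>, or does nothing if that
  coordinate is not in the gap; this keeps the gap in closed form.
\<close>

definition gap :: "nat \<Rightarrow> bool list list \<Rightarrow> nat set" where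
  "gap n h = {i. stays h \<le> i \<and> i < n \<and> (\<forall>x\<in>set h. x ! i)}"

text \<open>After the capture the cop has to freeze, since mirroring would then use burnt edges.\<close>

primrec cop_pos :: "nat \<Rightarrow> bool list list \<Rightarrow> bool list" where
  "cop_pos n [] = replicate n False"
| "cop_pos n (y # h) =
     (if gap n h = {} then cop_pos n h else map (\<lambda>i. i \<notin> gap n (y # h) \<and> y ! i) [0..<n])"

abbreviation hist :: "(nat \<Rightarrow> 'a) \<Rightarrow> nat \<Rightarrow> 'a list" where
  "hist r t \<equiv> rev (map r [0..<t])"

lemma length_cop_pos [simp]: "length (cop_pos n h) = n"
  by (induction h) auto

lemma gap_Cons_subset: "gap n (y # h) \<subseteq> gap n h"
  by (cases h) (auto simp: gap_def split: if_splits)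

lemma not_cop_pos_nth_gap:
  assumes "i \<in> gap n h"
  shows "\<not> cop_pos n h ! i"
proof (cases h)
  case (Cons y l)
  have "i < n" using assms by (simp add: gap_def)
  moreover have "gap n l \<noteq> {}" using assms gap_Cons_subset Cons by blast
  ultimately show ?thesis using assms Cons by simp
qed (use assms in \<open>simp add: gap_def\<close>)

lemma cop_pos_notin_history:
  assumes "gap n h \<noteq> {}"
  shows "cop_pos n h \<notin> set h"
  using assms not_cop_pos_nth_gap unfolding gap_def by blast

text \<open>While the gap is nonempty, a robber on the cop's vertex is \<open>False\<close> on all
  of it, so the next gap is empty and mirroring returns that same vertex.\<close>

lemma cop_pos_freeze:
  assumes "cop_pos n h = y"
  shows "cop_pos n (y # h) = y"
proof (cases "gap n h = {}")
  case False
  have "i \<notin> gap n (y # h)" for i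
    using assms not_cop_pos_nth_gap[of i n h] gap_Cons_subset[of n y h]
    by (auto simp: gap_def)
  then show ?thesis
    using False assms length_cop_pos[of n h] by (auto intro: nth_equalityI)
qed (use assms in simp)

lemma hypercube_arc_iff:
  "(x, y) \<in> parcs (hypercube n) \<longleftrightarrow>
     length x = n \<and> length y = n \<and>
     (\<exists>j<n. x ! j \<noteq> y ! j \<and> (\<forall>i<n. i \<noteq> j \<longrightarrow> x ! i = y ! i))"
proof -
  have "card {i. i < n \<and> x ! i \<noteq> y ! i} = 1 \<longleftrightarrow>
      (\<exists>j<n. x ! j \<noteq> y ! j \<and> (\<forall>i<n. i \<noteq> j \<longrightarrow> x ! i = y ! i))"
    unfolding card_1_singleton_iff One_nat_def by (auto simp: set_eq_iff)
  then show ?thesis by (simp add: hypercube_def)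
qed

lemma eq_or_hypercube_arcI:
  assumes "length x = n" "length y = n" "\<And>i. i < n \<Longrightarrow> i \<noteq> j \<Longrightarrow> x ! i = y ! i"
  shows "y = x \<or> (x, y) \<in> parcs (hypercube n)"
proof (cases "j < n \<and> x ! j \<noteq> y ! j")
  case True
  then show ?thesis using assms unfolding hypercube_arc_iff by blast
next
  case False
  then have "x ! i = y ! i" if "i < n" for i using assms(3) that by blast
  then have "x = y" using assms(1,2) by (simp add: list_eq_iff_nth_eq)
  then show ?thesis by simp
qed

lemma robber_play_step:
  assumes "robber_play G r"
  shows "r (Suc t) = r t \<or> (r t, r (Suc t)) \<in> remaining_arcs G r t"
  using assms by (auto simp: robber_play_def move_in_def)

lemma robber_play_hypercube_length:
  assumes "robber_play (hypercube n) r"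
  shows "length (r t) = n"
proof (induction t)
  case 0
  show ?case using assms by (simp add: robber_play_def hypercube_def)
next
  case (Suc t)
  then show ?case
    using robber_play_step[OF assms, of t] by (auto simp: remaining_arcs_def hypercube_arc_iff)
qed

text \<open>A burnt edge has both ends among the robber's positions up to time
  \<open>t\<close>.\<close>

lemma remaining_arcsI:
  assumes "(x, y) \<in> parcs G" "x \<notin> r ` {..t}"
  shows "(x, y) \<in> remaining_arcs G r t"
  using assms by (auto simp: remaining_arcs_def)

text \<open>If the robber just stayed, only the old value of \<open>stays\<close> can leave the gap;
  if he moved, only the coordinate he flipped can change in his position or in the gap.\<close>

lemma cop_pos_step:
  assumes "robber_play (hypercube n) r"
  shows "cop_pos n (hist r (Suc t)) = cop_pos n (hist r t) \<or>
    (cop_pos n (hist r t), cop_pos n (hist r (Suc t))) \<in> parcs (hypercube n)"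
proof (cases t)
  case 0
  \<comment> \<open>The first gap is the set where \<open>r 0\<close> is \<open>True\<close>, so the
    cop's first answer is still the all-\<open>False\<close> vertex.\<close>
  then show ?thesis by (auto simp: gap_def intro!: nth_equalityI)
next
  case (Suc s)
  have "\<exists>j. \<forall>i<n. i \<noteq> j \<longrightarrow>
      cop_pos n (hist r t) ! i = cop_pos n (hist r (Suc t)) ! i" if ne: "gap n (hist r t) \<noteq> {}"
  proof -
    have ne': "gap n (hist r s) \<noteq> {}"
      using ne gap_Cons_subset[of n "r s" "hist r s"] Suc by auto
    show ?thesis
    proof (cases "r t = r s")
      case True
      then have "\<forall>i<n. i \<noteq> stays (hist r t) \<longrightarrow> 
          cop_pos n (hist r t) ! i = cop_pos n (hist r (Suc t)) ! i"
        using ne ne' Suc by (auto simp: gap_def)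
      then show ?thesis by blast
    next
      case False
      then obtain j where j: "\<forall>i<n. i \<noteq> j \<longrightarrow> r s ! i = r t ! i"
        using robber_play_step[OF assms, of s] Suc
        by (auto simp: remaining_arcs_def hypercube_arc_iff)
      then have "\<forall>i<n. i \<noteq> j \<longrightarrow> 
          cop_pos n (hist r t) ! i = cop_pos n (hist r (Suc t)) ! i"
        using False ne ne' Suc by (auto simp: gap_def)
      then show ?thesis by blast
    qed
  qed
  moreover have "cop_pos n (hist r (Suc t)) = cop_pos n (hist r t)" if "gap n (hist r t) = {}"
    using that by simp
  ultimately show ?thesis
    using eq_or_hypercube_arcI[OF length_cop_pos length_cop_pos] by blast
qed

lemma cop_move_legal:
  assumes "robber_play (hypercube n) r"
  shows "move_in (remaining_arcs (hypercube n) r t)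
    (cop_pos n (hist r t)) (cop_pos n (hist r (Suc t)))"
proof (cases "cop_pos n (hist r (Suc t)) = cop_pos n (hist r t)")
  case False
  then have arc: "(cop_pos n (hist r t), cop_pos n (hist r (Suc t))) \<in> parcs (hypercube n)"
    using cop_pos_step[OF assms] by blast
  have "gap n (hist r t) \<noteq> {}" using False by auto
  then have "cop_pos n (hist r t) \<notin> r ` {..<t}"
    using cop_pos_notin_history[of n "hist r t"] by (simp add: atLeast0LessThan)
  \<comment> \<open>\<open>hist r t\<close> ends just before \<open>r t\<close>, so this vertex is
    treated separately: a cop standing there would not move.\<close>
  moreover have "cop_pos n (hist r t) \<noteq> r t"
    using False cop_pos_freeze[of n "hist r t" "r t"] by auto
  ultimately have "cop_pos n (hist r t) \<notin> r ` {..t}"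
    by (auto simp: le_less)
  then show ?thesis using arc by (simp add: move_in_def remaining_arcsI)
qed (simp add: move_in_def)

text \<open>Each round either adds a stay or burns at least one arc; \<open>hist r (Suc t)\<close>
  records exactly \<open>t\<close> rounds.\<close>

lemma card_remaining_arcs_le:
  assumes "finite (parcs G)" "robber_play G r"
  shows "card (remaining_arcs G r t) + t \<le> card (parcs G) + stays (hist r (Suc t))"
proof (induction t)
  case 0
  show ?case by (simp add: remaining_arcs_def)
next
  case (Suc t)
  have sub: "remaining_arcs G r (Suc t) \<subseteq> remaining_arcs G r t"
    unfolding remaining_arcs_def lessThan_Suc by blast
  have fin: "finite (remaining_arcs G r t)"
    using assms(1) by (simp add: remaining_arcs_def)
  show ?case
  proof (cases "r (Suc t) = r t")
    case True
    then show ?thesis using Suc card_mono[OF fin sub] by simp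
  next
    case False
    then have "(r t, r (Suc t)) \<in> remaining_arcs G r t - remaining_arcs G r (Suc t)"
      using robber_play_step[OF assms(2), of t] by (auto simp: remaining_arcs_def)
    then have "card (remaining_arcs G r (Suc t)) < card (remaining_arcs G r t)"
      using fin sub by (blast intro: psubset_card_mono)
    then show ?thesis using Suc False by simp
  qed
qed

lemma gap_eventually_empty:
  assumes "robber_play (hypercube n) r"
  shows "\<exists>t. gap n (hist r t) = {}"
proof -
  interpret pair_graph "hypercube n" by (rule pair_graph_hypercube)
  \<comment> \<open>So many rounds force \<open>n\<close> stays, after which
    \<open>stays h \<le> i\<close> excludes every \<open>i < n\<close>.\<close>
  let ?t = "card (parcs (hypercube n)) + n"
  have "n \<le> stays (hist r (Suc ?t))"
    using card_remaining_arcs_le[OF pair_finite_arcs assms, of ?t] by linarith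
  then show ?thesis by (intro exI[of _ "Suc ?t"]) (auto simp: gap_def)
qed

lemma cop_catches:
  assumes "robber_play (hypercube n) r" "n > 0"
  shows "\<exists>t. cop_pos n (hist r (Suc t)) = r t"
proof -
  \<comment> \<open>Just before the first empty gap the cop is not yet frozen, so he mirrors once
    more, now on all coordinates.\<close>
  let ?m = "LEAST t. gap n (hist r t) = {}"
  have empty: "gap n (hist r ?m) = {}"
    using gap_eventually_empty[OF assms(1)] by (rule LeastI_ex)
  moreover have "gap n (hist r 0) \<noteq> {}"
    using assms(2) by (auto simp: gap_def)
  ultimately obtain t where t: "?m = Suc t" by (metis not0_implies_Suc)
  then have "gap n (hist r t) \<noteq> {}"
    using not_less_Least[of t "\<lambda>t. gap n (hist r t) = {}"] by simp
  then have "cop_pos n (hist r (Suc t)) = map (\<lambda>i. r t ! i) [0..<n]"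
    using empty t by simp
  also have "\<dots> = r t"
    using robber_play_hypercube_length[OF assms(1), of t] by (metis map_nth)
  finally show ?thesis by blast
qed

lemma cops_win_hypercube:
  assumes "n > 0"
  shows "cops_win (hypercube n) 1"
proof -
  let ?\<sigma> = "\<lambda>h _. cop_pos n (rev h)"
  have "cop_strategy (hypercube n) 1 ?\<sigma>"
    using cop_move_legal by (simp add: cop_strategy_def cops_at_def hypercube_def)
  moreover have "captured 1 ?\<sigma> r" if "robber_play (hypercube n) r" for r
    using cop_catches[OF that assms] unfolding captured_def cops_at_def by blast
  ultimately show ?thesis unfolding cops_win_def by blast
qed

lemma not_cops_win_0:
  assumes "v \<in> pverts G"
  shows "\<not> cops_win G 0"
proof -
  have "robber_play G (\<lambda>_. v)" using assms by (simp add: robber_play_def move_in_def)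
  then show ?thesis by (auto simp: cops_win_def captured_def)
qed

theorem theorem4p12:
  fixes n :: nat
  assumes "n > 0"
  shows "bb_cop_number (hypercube n) = 1"
  unfolding bb_cop_number_def
proof (rule Least_equality)
  show "cops_win (hypercube n) 1" using assms by (rule cops_win_hypercube)
next
  fix k assume "cops_win (hypercube n) k"
  moreover have "replicate n False \<in> pverts (hypercube n)" by (simp add: hypercube_def)
  ultimately show "1 \<le> k" using not_cops_win_0 by (metis less_one not_le)
qed

end
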